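(* Let $\mathcal X,\mathcal Y$ be finite sets and let $\pi_1,\pi_2$ be arbitrary probability distributions on $\mathcal X\times\mathcal Y$. Then $$\mathcal R_{\mathrm S}(\pi_1\otimes\pi_2)=\mathcal R_{\mathrm S}(\pi_1)+\mathcal R_{\mathrm S}(\pi_2),$$ where the sum on the right is the Minkowski sum of subsets of $\mathbb R^2$. Consequently, for every probability distribution $\pi$ on $\mathcal X\times\mathcal Y$ and every positive integer $n$, $$\mathcal R_{\mathrm S}(\pi^{\otimes n})=n\,\mathcal R_{\mathrm S}(\pi),$$ where $n\,\mathcal R_{\mathrm S}(\pi)=\{n r: r\in\mathcal R_{\mathrm S}(\pi)\}$.
   Context: All alphabets are finite and all logarithms are natural; conventions $0\log 0=0$ and $0\cdot\infty=0$. $H$ denotes Shannon entropy and $I$ mutual information. For probability distributions $P$ on a finite set $\mathcal A$ and $Q$ on a finite set $\mathcal B$, let $\mathcal C(P,Q)$ be the set of couplings of $P$ and $Q$. For a cost $c:\mathcal A\times\mathcal B\to[0,\infty]$ define $$\mathcal T_c(P,Q):=\sup_{R\in\mathcal C(P,Q)}\mathbb E_R[c(X,Y)],\qquad \Phi_c(P,Q):=\mathcal T_c(P,Q)-H(P)-H(Q).$$ For a probability distribution $\pi$ on $\mathcal A\times\mathcal B$, put $c_\pi(x,y):=\log\frac1{\pi(x,y)}$, with $c_\pi(x,y)=+\infty$ when $\pi(x,y)=0$, and let $\mathcal R_{\mathrm S}(\pi)$ be the set of pairs $(R_{\mathrm S},R)\in[0,\infty)^2$ for which there exists a joint distribution $P_{WXY}=P_WP_{X|W}P_{Y|W}$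 (with $W$ taking values in some finite alphabet, $X\in\mathcal A$, $Y\in\mathcal B$) such that $$P_{XY}=\pi,\qquad R\ge I(W;X),\qquad R_{\mathrm S}\ge \mathbb E_W\big[\Phi_{c_\pi}(P_{X|W},P_{Y|W})\big]=\sum_wP_W(w)\Phi_{c_\pi}(P_{X|W=w},P_{Y|W=w}).$$ The product $\pi_1\otimes\pi_2$ is regarded as a bivariate source on $\mathcal X^2\times\mathcal Y^2$, i.e. as the distribution of $((X_1,X_2),(Y_1,Y_2))$ with probability $\pi_1(x_1,y_1)\pi_2(x_2,y_2)$; likewise $\pi^{\otimes n}$ is regarded as the distribution of $(X^n,Y^n)$ on $\mathcal X^n\times\mathcal Y^n$ with probability $\prod_{i=1}^n\pi(x_i,y_i)$. *)

theory Defs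
  imports "HOL-Probability.Probability" "HOL-Library.Set_Algebras"
begin

(* Distributions are pmfs.  An alphabet is represented by the (finite) support of the pmfs living
   on it, inside a possibly infinite countable type: sequences are lists, and W ranges over nat. *)

definition entropy_nats :: "'a::countable pmf \<Rightarrow> real" where
  "entropy_nats P = prob_space.entropy (measure_pmf P) (exp 1) (count_space UNIV) (\<lambda>x. x)"

definition mutual_information_nats ::
    "'s pmf \<Rightarrow> ('s \<Rightarrow> 'a::countable) \<Rightarrow> ('s \<Rightarrow> 'b::countable) \<Rightarrow> real" where
  "mutual_information_nats J U V =
     prob_space.mutual_information (measure_pmf J) (exp 1) (count_space UNIV) (count_space UNIV) U V"

lemma information_space_pmf: "information_space (measure_pmf P) (exp 1)"
  by unfold_locales simp

lemma distributed_pmf: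
  "distributed (measure_pmf J) (count_space UNIV) U (\<lambda>x. ennreal (pmf (map_pmf U J) x))"
  unfolding distributed_def
  by (auto simp: map_pmf_rep_eq[symmetric] measure_pmf_eq_density[symmetric])

lemma entropy_nats_eq_sum:
  fixes P :: "'a::countable pmf"
  assumes "finite (set_pmf P)"
  shows "entropy_nats P = - (\<Sum>x\<in>set_pmf P. pmf P x * ln (pmf P x))"
proof -
  interpret information_space "measure_pmf P" "exp 1" by (rule information_space_pmf)
  have "entropy_nats P = - (\<integral>x. pmf P x * log (exp 1) (pmf P x) \<partial>count_space UNIV)"
    unfolding entropy_nats_def using distributed_pmf[of P "\<lambda>x. x"]
    by (intro entropy_distr) (auto simp: map_pmf_ident)
  also have "(\<integral>x. pmf P x * log (exp 1) (pmf P x) \<partial>count_space UNIV)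
      = (\<Sum>x\<in>set_pmf P. pmf P x * ln (pmf P x))"
    by (subst lebesgue_integral_count_space_finite_support)
       (auto simp: log_def set_pmf_eq intro!: finite_subset[OF _ assms] sum.mono_neutral_left assms)
  finally show ?thesis .
qed

lemma mutual_information_nats_eq_sum:
  fixes U :: "'s \<Rightarrow> 'a::countable" and V :: "'s \<Rightarrow> 'b::countable"
  defines "Q J \<equiv> map_pmf (\<lambda>s. (U s, V s)) J"
  assumes "finite (set_pmf (Q J))"
  shows "mutual_information_nats J U V =
    (\<Sum>(u, v)\<in>set_pmf (Q J). pmf (Q J) (u, v) *
        ln (pmf (Q J) (u, v) / (pmf (map_pmf U J) u * pmf (map_pmf V J) v)))"
proof -
  interpret information_space "measure_pmf J" "exp 1" by (rule information_space_pmf)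
  let ?f = "\<lambda>x. pmf (Q J) x *
    log (exp 1) (pmf (Q J) x / (pmf (map_pmf U J) (fst x) * pmf (map_pmf V J) (snd x)))"
  have pm: "count_space (UNIV :: 'a set) \<Otimes>\<^sub>M count_space (UNIV :: 'b set) = count_space UNIV"
    by (subst pair_measure_countable) auto
  have "mutual_information_nats J U V = (\<integral>x. ?f x \<partial>(count_space UNIV \<Otimes>\<^sub>M count_space UNIV))"
    unfolding mutual_information_nats_def
    by (intro mutual_information_distr sigma_finite_measure_count_space distributed_pmf)
       (auto simp: pm Q_def intro: distributed_pmf)
  also have "\<dots> = (\<integral>x. ?f x \<partial>count_space UNIV)" unfolding pm ..
  also have "\<dots> = (\<Sum>x\<in>set_pmf (Q J). ?f x)"
    by (subst lebesgue_integral_count_space_finite_support)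
       (auto simp: set_pmf_eq intro!: finite_subset[OF _ assms(2)] sum.mono_neutral_left assms(2))
  finally show ?thesis by (simp add: log_def split_beta)
qed

definition couplings :: "'a pmf \<Rightarrow> 'b pmf \<Rightarrow> ('a \<times> 'b) pmf set" where
  "couplings P Q = {R. map_pmf fst R = P \<and> map_pmf snd R = Q}"

definition max_transport :: "('a \<times> 'b \<Rightarrow> ennreal) \<Rightarrow> 'a pmf \<Rightarrow> 'b pmf \<Rightarrow> ennreal" where
  "max_transport c P Q = (\<Squnion>R\<in>couplings P Q. \<integral>\<^sup>+z. c z \<partial>measure_pmf R)"

definition Phi :: "('a \<times> 'b \<Rightarrow> ennreal) \<Rightarrow> 'a::countable pmf \<Rightarrow> 'b::countable pmf \<Rightarrow> ereal" where
  "Phi c P Q = enn2ereal (max_transport c P Q) - ereal (entropy_nats P) - ereal (entropy_nats Q)"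

definition log_cost :: "('a \<times> 'b) pmf \<Rightarrow> 'a \<times> 'b \<Rightarrow> ennreal" where
  "log_cost \<pi> z = (if pmf \<pi> z = 0 then \<infinity> else ennreal (ln (1 / pmf \<pi> z)))"

(* The law of (W, X, Y) with P_WXY = P_W P_X|W P_Y|W; the kernels are K = P_X|W and L = P_Y|W. *)
definition markov_joint ::
    "'w pmf \<Rightarrow> ('w \<Rightarrow> 'a pmf) \<Rightarrow> ('w \<Rightarrow> 'b pmf) \<Rightarrow> ('w \<times> 'a \<times> 'b) pmf" where
  "markov_joint p K L = bind_pmf p (\<lambda>w. map_pmf (Pair w) (pair_pmf (K w) (L w)))"

lemma pmf_markov_joint:
  "pmf (markov_joint p K L) (w, x, y) = pmf p w * pmf (K w) x * pmf (L w) y"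
proof -
  have "pmf (map_pmf (Pair v) (pair_pmf (K v) (L v))) (w, x, y)
      = indicator {w} v * (pmf (K w) x * pmf (L w) y)" for v
  proof (cases "v = w")
    case True
    then show ?thesis
      using pmf_map_inj'[of "Pair w" "pair_pmf (K w) (L w)" "(x, y)"]
      by (auto simp: inj_on_def pmf_pair)
  next
    case False
    then show ?thesis by (auto simp: pmf_eq_0_set_pmf)
  qed
  then show ?thesis
    by (simp add: markov_joint_def pmf_bind measure_pmf_single)
qed

(* Any finite alphabet for W embeds into nat.  The alphabets of X and Y need not be mentioned:
   see support_kernels below. *)
definition region :: "('a::countable \<times> 'b::countable) pmf \<Rightarrow> (real \<times> real) set" where
  "region \<pi> = {(r\<^sub>S, r). 0 \<le> r\<^sub>S \<and> 0 \<le> r \<and>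
     (\<exists>(p :: nat pmf) K L. finite (set_pmf p) \<and>
        map_pmf snd (markov_joint p K L) = \<pi> \<and>
        r \<ge> mutual_information_nats (markov_joint p K L) fst (\<lambda>(w, x, y). x) \<and>
        ereal r\<^sub>S \<ge> (\<Sum>w\<in>set_pmf p. ereal (pmf p w) * Phi (log_cost \<pi>) (K w) (L w)))}"

lemma support_kernels:
  assumes "map_pmf snd (markov_joint p K L) = \<pi>" "w \<in> set_pmf p" "set_pmf \<pi> \<subseteq> A \<times> B"
  shows "set_pmf (K w) \<subseteq> A" "set_pmf (L w) \<subseteq> B"
proof -
  have "set_pmf (K w) \<times> set_pmf (L w) \<subseteq> set_pmf \<pi>"
    using assms(2) unfolding assms(1)[symmetric] markov_joint_def by (force simp: image_iff)
  with assms(3) have "set_pmf (K w) \<times> set_pmf (L w) \<subseteq> A \<times> B" by blast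
  then show "set_pmf (K w) \<subseteq> A" "set_pmf (L w) \<subseteq> B"
    using set_pmf_not_empty[of "K w"] set_pmf_not_empty[of "L w"] by blast+
qed

definition product_source ::
    "('a \<times> 'b) pmf \<Rightarrow> ('c \<times> 'd) pmf \<Rightarrow> (('a \<times> 'c) \<times> ('b \<times> 'd)) pmf" where
  "product_source \<pi>\<^sub>1 \<pi>\<^sub>2 =
     map_pmf (\<lambda>((x\<^sub>1, y\<^sub>1), (x\<^sub>2, y\<^sub>2)). ((x\<^sub>1, x\<^sub>2), (y\<^sub>1, y\<^sub>2))) (pair_pmf \<pi>\<^sub>1 \<pi>\<^sub>2)"

lemma pmf_product_source:
  "pmf (product_source \<pi>\<^sub>1 \<pi>\<^sub>2) ((x\<^sub>1, x\<^sub>2), (y\<^sub>1, y\<^sub>2)) = pmf \<pi>\<^sub>1 (x\<^sub>1, y\<^sub>1) * pmf \<pi>\<^sub>2 (x\<^sub>2, y\<^sub>2)"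
proof -
  let ?f = "\<lambda>((x\<^sub>1, y\<^sub>1), (x\<^sub>2, y\<^sub>2)). ((x\<^sub>1, x\<^sub>2), (y\<^sub>1, y\<^sub>2))"
  have "inj ?f" by (auto simp: inj_on_def)
  from pmf_map_inj'[OF this, of "pair_pmf \<pi>\<^sub>1 \<pi>\<^sub>2" "((x\<^sub>1, y\<^sub>1), (x\<^sub>2, y\<^sub>2))"]
  show ?thesis by (simp add: product_source_def pmf_pair)
qed

(* X^n and Y^n are represented as lists of length n. *)
definition iid_source :: "nat \<Rightarrow> ('a \<times> 'b) pmf \<Rightarrow> ('a list \<times> 'b list) pmf" where
  "iid_source n \<pi> = map_pmf (\<lambda>zs. (map fst zs, map snd zs)) (replicate_pmf n \<pi>)"

lemma pmf_replicate_pmf: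
  "length zs = n \<Longrightarrow> pmf (replicate_pmf n \<pi>) zs = (\<Prod>i<n. pmf \<pi> (zs ! i))"
proof (induction n arbitrary: zs)
  case (Suc n)
  then obtain z zs' where zs: "zs = z # zs'" "length zs' = n" by (cases zs) auto
  have "replicate_pmf (Suc n) \<pi> = map_pmf (\<lambda>(x, xs). x # xs) (pair_pmf \<pi> (replicate_pmf n \<pi>))"
    by (simp add: pair_pmf_def map_bind_pmf)
  moreover have "inj (\<lambda>(x :: 'a, xs). x # xs)" by (auto simp: inj_on_def)
  from pmf_map_inj'[OF this, of "pair_pmf \<pi> (replicate_pmf n \<pi>)" "(z, zs')"]
  have "pmf (map_pmf (\<lambda>(x, xs). x # xs) (pair_pmf \<pi> (replicate_pmf n \<pi>))) zs
      = pmf \<pi> z * pmf (replicate_pmf n \<pi>) zs'" by (simp add: zs pmf_pair)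
  ultimately show ?case using Suc.IH[OF zs(2)] by (simp add: zs prod.lessThan_Suc_shift del: prod.lessThan_Suc)
qed simp

lemma pmf_iid_source:
  assumes "length xs = n" "length ys = n"
  shows "pmf (iid_source n \<pi>) (xs, ys) = (\<Prod>i<n. pmf \<pi> (xs ! i, ys ! i))"
proof -
  have "inj (\<lambda>zs :: ('a \<times> 'b) list. (map fst zs, map snd zs))"
    by (rule inj_on_inverseI[where g = "\<lambda>(xs, ys). zip xs ys"]) (simp add: zip_map_fst_snd)
  from pmf_map_inj'[OF this, of "replicate_pmf n \<pi>" "zip xs ys"]
  show ?thesis using assms by (simp add: iid_source_def pmf_replicate_pmf)
qed

end

theory Submission
  imports Defs
begin

text \<open>Write \<open>\<phi>(P, Q)\<close> for \<open>\<Phi>\<close> with cost \<open>-log \<pi>\<close>. One inclusion takes independent auxiliary variables: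
  restricting a coupling of product laws to the two factors shows that \<open>\<phi>\<close> is subadditive.
  For the other, let \<open>W\<close> be an auxiliary variable for the product source and use
  \<open>W\<^sub>1 = (W, Y\<^sub>2)\<close> and \<open>W\<^sub>2 = (W, X\<^sub>1)\<close>. The chain rule splits all entropies and informations
  exactly, and near-maximal couplings of \<open>P(X\<^sub>1|W)\<close> with \<open>P(Y\<^sub>1|W, Y\<^sub>2)\<close> and of \<open>P(X\<^sub>2|W, X\<^sub>1)\<close> with
  \<open>P(Y\<^sub>2|W)\<close> glue along the independent pair \<open>(X\<^sub>1, Y\<^sub>2)\<close> to a coupling of the pairs, so the
  costs add up. The statement on \<open>n\<close>-fold products follows by induction, because time sharing makes
  the region convex.\<close>

abbreviation expect :: "'a pmf \<Rightarrow> ('a \<Rightarrow> real) \<Rightarrow> real" where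
  "expect \<equiv> measure_pmf.expectation"

subsection \<open>Expectations and disintegration\<close>

lemma expect_cong:
  "(\<And>x. x \<in> set_pmf p \<Longrightarrow> f x = g x) \<Longrightarrow> expect p f = expect p g"
  by (intro integral_cong_AE) (auto simp: AE_measure_pmf_iff)

lemma expect_mono:
  assumes "finite (set_pmf p)" "\<And>x. x \<in> set_pmf p \<Longrightarrow> f x \<le> g x"
  shows "expect p f \<le> expect p g"
  using assms by (intro integral_mono_AE) (auto simp: AE_measure_pmf_iff integrable_measure_pmf_finite)

lemma expect_eq_sum:
  "finite (set_pmf p) \<Longrightarrow> expect p f = (\<Sum>x\<in>set_pmf p. pmf p x * f x)"
  by (subst integral_measure_pmf[of "set_pmf p"]) auto

lemma expect_add:
  "finite (set_pmf p) \<Longrightarrow> expect p (\<lambda>x. f x + g x) = expect p f + expect p g"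
  by (simp add: integrable_measure_pmf_finite)

lemma expect_diff:
  "finite (set_pmf p) \<Longrightarrow> expect p (\<lambda>x. f x - g x) = expect p f - expect p g"
  by (simp add: integrable_measure_pmf_finite)

lemma expect_bind:
  assumes "finite (set_pmf p)" "\<And>x. x \<in> set_pmf p \<Longrightarrow> finite (set_pmf (f x))"
  shows "expect (bind_pmf p f) h = expect p (\<lambda>x. expect (f x) h)"
  using assms by (subst pmf_expectation_bind[of "set_pmf p"]) (auto simp: expect_eq_sum)

lemma expect_pair:
  assumes "finite (set_pmf p)" "finite (set_pmf q)"
  shows "expect (pair_pmf p q) f = expect p (\<lambda>x. expect q (\<lambda>y. f (x, y)))"
  unfolding pair_pmf_def using assms by (simp add: expect_bind)

lemma expect_pair_add:
  assumes "finite (set_pmf p)" "finite (set_pmf q)"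
  shows "expect (pair_pmf p q) (\<lambda>(x, y). f x + g y) = expect p f + expect q g"
  using assms by (simp add: expect_pair integrable_measure_pmf_finite)

lemma pmf_bind_Pair: "pmf (bind_pmf p (\<lambda>w. map_pmf (Pair w) (K w))) (w, x) = pmf p w * pmf (K w) x"
proof -
  have "pmf (map_pmf (Pair v) (K v)) (w, x) = indicator {w} v * pmf (K w) x" for v
    using pmf_map_inj'[of "Pair w" "K w" x]
    by (cases "v = w") (auto simp: inj_on_def pmf_eq_0_set_pmf)
  then show ?thesis by (simp add: pmf_bind measure_pmf_single)
qed

text \<open>\<open>C x\<close> is the second coordinate of \<open>P\<close> conditioned on first
  coordinate x. For x of mass zero it is arbitrary, which does no harm because the outer bind never
  visits such x.\<close>

lemma disintegrate_fst:
  obtains C where "P = bind_pmf (map_pmf fst P) (\<lambda>x. map_pmf (Pair x) (C x))"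
proof
  have cond: "bind_pmf (map_pmf fst P) (\<lambda>x. cond_pmf P {z. x = fst z}) = P"
    by (intro bind_cond_pmf_cancel) (auto simp: vimage_def eq_commute image_iff)
  have "map_pmf (Pair x) (map_pmf snd (cond_pmf P {z. x = fst z})) = cond_pmf P {z. x = fst z}"
    if "x \<in> set_pmf (map_pmf fst P)" for x
  proof -
    have "map_pmf (\<lambda>z. (x, snd z)) (cond_pmf P {z. x = fst z}) = map_pmf id (cond_pmf P {z. x = fst z})"
      using that by (intro map_pmf_cong refl) (subst (asm) set_cond_pmf, auto)
    then show ?thesis by (simp add: map_pmf_comp)
  qed
  then show "P = bind_pmf (map_pmf fst P) (\<lambda>x. map_pmf (Pair x) (map_pmf snd (cond_pmf P {z. x = fst z})))"
    by (subst cond[symmetric]) (auto intro!: bind_pmf_cong)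
qed

lemma disintegrate_snd:
  obtains D where "Q = bind_pmf (map_pmf snd Q) (\<lambda>y. map_pmf (\<lambda>x. (x, y)) (D y))"
proof -
  obtain D where D: "map_pmf prod.swap Q
      = bind_pmf (map_pmf fst (map_pmf prod.swap Q)) (\<lambda>y. map_pmf (Pair y) (D y))"
    by (rule disintegrate_fst)
  have "map_pmf prod.swap (map_pmf prod.swap Q)
      = bind_pmf (map_pmf snd Q) (\<lambda>y. map_pmf (\<lambda>x. (x, y)) (D y))"
    by (subst D) (simp add: map_bind_pmf map_pmf_comp prod.swap_def)
  then show ?thesis using that by (simp add: map_pmf_comp map_pmf_ident)
qed

subsection \<open>Entropy\<close>

lemma entropy_nats_eq_expect:
  "finite (set_pmf P) \<Longrightarrow> entropy_nats P = expect P (\<lambda>x. - ln (pmf P x))"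
  by (simp add: entropy_nats_eq_sum expect_eq_sum sum_negf)

text \<open>Gibbs' inequality, from ln t \<le> t - 1 at t = Q(x) / P(x). The support inclusion makes
  every such ratio positive, so that no logarithm is taken at 0.\<close>

lemma entropy_nats_le_cross_entropy:
  assumes "finite (set_pmf P)" "set_pmf P \<subseteq> set_pmf Q"
  shows "entropy_nats P \<le> expect P (\<lambda>x. - ln (pmf Q x))"
proof -
  have "(\<Sum>x\<in>set_pmf P. pmf P x * (ln (pmf Q x) - ln (pmf P x))) \<le> (\<Sum>x\<in>set_pmf P. pmf Q x - pmf P x)"
  proof (rule sum_mono)
    fix x assume x: "x \<in> set_pmf P"
    then have pos: "0 < pmf P x" "0 < pmf Q x" using assms(2) by (auto simp: pmf_positive)
    then have "ln (pmf Q x) - ln (pmf P x) \<le> pmf Q x / pmf P x - 1"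
      using ln_le_minus_one[of "pmf Q x / pmf P x"] by (simp add: ln_div)
    then have "pmf P x * (ln (pmf Q x) - ln (pmf P x)) \<le> pmf P x * (pmf Q x / pmf P x - 1)"
      using pos by (intro mult_left_mono) auto
    also have "\<dots> = pmf Q x - pmf P x" using pos by (simp add: field_simps)
    finally show "pmf P x * (ln (pmf Q x) - ln (pmf P x)) \<le> pmf Q x - pmf P x" .
  qed
  \<comment> \<open>Over the support of \<open>P\<close> the masses of \<open>P\<close> add up to 1,
    those of \<open>Q\<close> to at most 1.\<close>
  also have "\<dots> \<le> 0"
    using assms(1) measure_pmf.prob_le_1[of Q "set_pmf P"]
    by (simp add: sum_subtractf sum_pmf_eq_1 measure_measure_pmf_finite)
  finally show ?thesis
    using assms(1) by (simp add: entropy_nats_eq_expect expect_eq_sum algebra_simps sum_subtractf sum_negf)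
qed

text \<open>Concavity of entropy: compare each component with the mixture by cross entropy. These
  cross entropies average to the entropy of the mixture.\<close>

lemma entropy_nats_bind_ge:
  assumes "finite (set_pmf p)" "\<And>w. w \<in> set_pmf p \<Longrightarrow> finite (set_pmf (F w))"
  shows "expect p (\<lambda>w. entropy_nats (F w)) \<le> entropy_nats (bind_pmf p F)"
proof -
  have "expect p (\<lambda>w. entropy_nats (F w))
      \<le> expect p (\<lambda>w. expect (F w) (\<lambda>x. - ln (pmf (bind_pmf p F) x)))"
    using assms by (intro expect_mono entropy_nats_le_cross_entropy) auto
  also have "\<dots> = expect (bind_pmf p F) (\<lambda>x. - ln (pmf (bind_pmf p F) x))"
    using assms by (intro expect_bind[symmetric]) auto
  also have "\<dots> = entropy_nats (bind_pmf p F)"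
    using assms by (intro entropy_nats_eq_expect[symmetric]) auto
  finally show ?thesis .
qed

text \<open>The chain rule H(W, X) = H(W) + H(X|W): on the support the joint mass is a product of
  positive factors, so its logarithm splits.\<close>

lemma entropy_nats_chain:
  assumes "finite (set_pmf p)" "\<And>w. w \<in> set_pmf p \<Longrightarrow> finite (set_pmf (K w))"
  shows "entropy_nats (bind_pmf p (\<lambda>w. map_pmf (Pair w) (K w)))
    = entropy_nats p + expect p (\<lambda>w. entropy_nats (K w))"
proof -
  let ?Q = "bind_pmf p (\<lambda>w. map_pmf (Pair w) (K w))"
  have "entropy_nats ?Q = expect ?Q (\<lambda>z. - ln (pmf ?Q z))"
    using assms by (intro entropy_nats_eq_expect) auto
  also have "\<dots> = expect p (\<lambda>w. expect (K w) (\<lambda>x. - ln (pmf ?Q (w, x))))"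
    using assms by (subst expect_bind) auto
  also have "\<dots> = expect p (\<lambda>w. - ln (pmf p w) + entropy_nats (K w))"
  proof (rule expect_cong)
    fix w assume w: "w \<in> set_pmf p"
    have "expect (K w) (\<lambda>x. - ln (pmf ?Q (w, x))) = expect (K w) (\<lambda>x. - ln (pmf p w) + - ln (pmf (K w) x))"
      using w by (intro expect_cong) (auto simp: pmf_bind_Pair ln_mult pmf_eq_0_set_pmf)
    also have "\<dots> = - ln (pmf p w) + entropy_nats (K w)"
      using assms w by (subst expect_add) (auto simp: entropy_nats_eq_expect)
    finally show "expect (K w) (\<lambda>x. - ln (pmf ?Q (w, x))) = - ln (pmf p w) + entropy_nats (K w)" .
  qed
  also have "\<dots> = entropy_nats p + expect p (\<lambda>w. entropy_nats (K w))"
    using assms by (subst expect_add) (auto simp: entropy_nats_eq_expect)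
  finally show ?thesis .
qed

lemma entropy_nats_map_inj:
  assumes "finite (set_pmf P)" "inj_on f (set_pmf P)"
  shows "entropy_nats (map_pmf f P) = entropy_nats P"
proof -
  have "entropy_nats (map_pmf f P) = expect P (\<lambda>x. - ln (pmf (map_pmf f P) (f x)))"
    using assms(1) by (simp add: entropy_nats_eq_expect)
  also have "\<dots> = expect P (\<lambda>x. - ln (pmf P x))"
    using assms(2) by (intro expect_cong) (simp add: pmf_map_inj)
  finally show ?thesis using assms(1) by (simp add: entropy_nats_eq_expect)
qed

lemma entropy_nats_pair:
  assumes "finite (set_pmf P)" "finite (set_pmf Q)"
  shows "entropy_nats (pair_pmf P Q) = entropy_nats P + entropy_nats Q"
proof -
  have "pair_pmf P Q = bind_pmf P (\<lambda>x. map_pmf (Pair x) Q)"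
    by (simp add: pair_pmf_def map_pmf_def)
  then show ?thesis using entropy_nats_chain[of P "\<lambda>_. Q"] assms by simp
qed

lemma map_snd_markov_joint:
  "map_pmf snd (markov_joint p K L) = bind_pmf p (\<lambda>w. pair_pmf (K w) (L w))"
  by (simp add: markov_joint_def map_bind_pmf map_pmf_comp map_pmf_ident)

text \<open>This is I(W; X) = H(X) - H(X|W). The mass of w cancels in the density ratio, leaving the
  ratio of \<open>K w\<close> to the mixture.\<close>

lemma mutual_information_markov_joint:
  fixes p :: "'w::countable pmf" and K :: "'w \<Rightarrow> 'a::countable pmf"
  assumes "finite (set_pmf p)" "\<And>w. w \<in> set_pmf p \<Longrightarrow> finite (set_pmf (K w))"
  shows "mutual_information_nats (markov_joint p K L) fst (\<lambda>(w, x, y). x)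
    = entropy_nats (bind_pmf p K) - expect p (\<lambda>w. entropy_nats (K w))"
proof -
  let ?J = "markov_joint p K L" and ?X = "\<lambda>(w, x, y). x" and ?Q = "bind_pmf p (\<lambda>w. map_pmf (Pair w) (K w))"
  have Q: "map_pmf (\<lambda>s. (fst s, ?X s)) ?J = ?Q"
    by (simp add: markov_joint_def map_bind_pmf map_pmf_comp split_beta)
       (simp flip: map_pmf_comp[of "Pair _" fst] add: map_fst_pair_pmf)
  have W: "map_pmf fst ?J = p"
    by (simp add: markov_joint_def map_bind_pmf map_pmf_comp map_pmf_const bind_return_pmf')
  have X: "map_pmf ?X ?J = bind_pmf p K"
    by (simp add: markov_joint_def map_bind_pmf map_pmf_comp split_beta map_fst_pair_pmf)
  have fin: "finite (set_pmf ?Q)" using assms by auto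
  have "mutual_information_nats ?J fst ?X
      = expect ?Q (\<lambda>(w, x). ln (pmf ?Q (w, x) / (pmf p w * pmf (bind_pmf p K) x)))"
    using mutual_information_nats_eq_sum[of fst ?X ?J] fin
    unfolding Q W X by (simp add: expect_eq_sum split_beta)
  also have "\<dots> = expect p (\<lambda>w. expect (K w) (\<lambda>x. ln (pmf ?Q (w, x) / (pmf p w * pmf (bind_pmf p K) x))))"
    using assms by (subst expect_bind) auto
  also have "\<dots> = expect p (\<lambda>w. expect (K w) (\<lambda>x. - ln (pmf (bind_pmf p K) x)) - entropy_nats (K w))"
  proof (rule expect_cong)
    fix w assume w: "w \<in> set_pmf p"
    have "expect (K w) (\<lambda>x. ln (pmf ?Q (w, x) / (pmf p w * pmf (bind_pmf p K) x)))
        = expect (K w) (\<lambda>x. - ln (pmf (bind_pmf p K) x) - - ln (pmf (K w) x))"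
    proof (rule expect_cong)
      fix x assume x: "x \<in> set_pmf (K w)"
      then have "0 < pmf p w" "0 < pmf (K w) x" "0 < pmf (bind_pmf p K) x"
        using w by (auto intro!: pmf_positive)
      then show "ln (pmf ?Q (w, x) / (pmf p w * pmf (bind_pmf p K) x)) = - ln (pmf (bind_pmf p K) x) - - ln (pmf (K w) x)"
        by (simp add: pmf_bind_Pair ln_div)
    qed
    also have "\<dots> = expect (K w) (\<lambda>x. - ln (pmf (bind_pmf p K) x)) - entropy_nats (K w)"
      using assms w by (subst expect_diff) (auto simp: entropy_nats_eq_expect)
    finally show "expect (K w) (\<lambda>x. ln (pmf ?Q (w, x) / (pmf p w * pmf (bind_pmf p K) x))) = \<dots>" .
  qed
  also have "\<dots> = entropy_nats (bind_pmf p K) - expect p (\<lambda>w. entropy_nats (K w))"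
    using assms by (subst expect_diff) (auto simp: entropy_nats_eq_expect expect_bind)
  finally show ?thesis .
qed

subsection \<open>Maximal couplings\<close>

text \<open>Real-valued counterpart of \<open>max_transport\<close>; the supremum is meaningful when
  the expectations are bounded, as they are for finitely supported marginals.\<close>

definition transport :: "('a \<times> 'b \<Rightarrow> real) \<Rightarrow> 'a pmf \<Rightarrow> 'b pmf \<Rightarrow> real" where
  "transport c P Q = (\<Squnion>R\<in>couplings P Q. expect R c)"

text \<open>Agrees with \<open>log_cost\<close> on the support of \<pi> only: elsewhere the value is
  0, because \<open>ln 0 = 0\<close>, and not infinity.\<close>

definition log_loss :: "('a \<times> 'b) pmf \<Rightarrow> 'a \<times> 'b \<Rightarrow> real" where
  "log_loss \<pi> z = - ln (pmf \<pi> z)"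

definition phi :: "('a::countable \<times> 'b::countable) pmf \<Rightarrow> 'a pmf \<Rightarrow> 'b pmf \<Rightarrow> real" where
  "phi \<pi> P Q = transport (log_loss \<pi>) P Q - entropy_nats P - entropy_nats Q"

lemma pair_in_couplings: "pair_pmf P Q \<in> couplings P Q"
  by (simp add: couplings_def map_fst_pair_pmf map_snd_pair_pmf)

lemma set_pmf_coupling: "R \<in> couplings P Q \<Longrightarrow> set_pmf R \<subseteq> set_pmf P \<times> set_pmf Q"
  by (force simp: couplings_def)

lemma finite_coupling:
  "R \<in> couplings P Q \<Longrightarrow> finite (set_pmf P) \<Longrightarrow> finite (set_pmf Q) \<Longrightarrow> finite (set_pmf R)"
  by (rule finite_subset[OF set_pmf_coupling]) auto

lemma bdd_above_couplings:
  assumes "finite (set_pmf P)" "finite (set_pmf Q)"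
  shows "bdd_above ((\<lambda>R. expect R c) ` couplings P Q)"
proof (rule bdd_aboveI2)
  fix R assume R: "R \<in> couplings P Q"
  have "expect R c \<le> expect R (\<lambda>_. Max (c ` (set_pmf P \<times> set_pmf Q)))"
    using R assms set_pmf_coupling[OF R] by (intro expect_mono finite_coupling[OF R] Max_ge) auto
  then show "expect R c \<le> Max (c ` (set_pmf P \<times> set_pmf Q))" by simp
qed

lemma transport_ge:
  assumes "finite (set_pmf P)" "finite (set_pmf Q)" "R \<in> couplings P Q"
  shows "expect R c \<le> transport c P Q"
  unfolding transport_def using assms by (intro cSUP_upper bdd_above_couplings)

lemma transport_le:
  assumes "\<And>R. R \<in> couplings P Q \<Longrightarrow> expect R c \<le> B"
  shows "transport c P Q \<le> B"
  unfolding transport_def using assms pair_in_couplings by (intro cSUP_least) auto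

text \<open>If every coupling fell short by \<open>e\<close>, the supremum would too. Slack
  \<open>e\<close> avoids any compactness argument for the existence of a maximiser.\<close>

lemma near_maximal_coupling:
  assumes "0 < e"
  obtains R where "R \<in> couplings P Q" "transport c P Q \<le> expect R c + e"
proof -
  have "\<not> (\<forall>R\<in>couplings P Q. expect R c \<le> transport c P Q - e)"
    using transport_le[of P Q c "transport c P Q - e"] assms by auto
  then show ?thesis using that by force
qed

text \<open>A coupling lives on the product of the supports of its marginals, hence inside the
  support of \<pi>, where the cost is finite and nonnegative. From here on real arithmetic
  suffices.\<close>

lemma Phi_eq_phi:
  assumes fin: "finite (set_pmf P)" "finite (set_pmf Q)" and sub: "set_pmf P \<times> set_pmf Q \<subseteq> set_pmf \<pi>"
  shows "Phi (log_cost \<pi>) P Q = ereal (phi \<pi> P Q)"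
proof -
  have nn: "0 \<le> log_loss \<pi> z" if "z \<in> set_pmf \<pi>" for z
    using that pmf_le_1[of \<pi> z] by (simp add: log_loss_def pmf_positive)
  have R: "(\<integral>\<^sup>+z. log_cost \<pi> z \<partial>measure_pmf R) = ennreal (expect R (log_loss \<pi>))"
      "0 \<le> expect R (log_loss \<pi>)" if R: "R \<in> couplings P Q" for R
  proof -
    have supp: "set_pmf R \<subseteq> set_pmf \<pi>" using set_pmf_coupling[OF R] sub by blast
    have "(\<integral>\<^sup>+z. log_cost \<pi> z \<partial>measure_pmf R) = (\<integral>\<^sup>+z. ennreal (log_loss \<pi> z) \<partial>measure_pmf R)"
      using supp by (intro nn_integral_cong_AE)
        (auto simp: AE_measure_pmf_iff log_cost_def log_loss_def pmf_eq_0_set_pmf ln_div pmf_positive)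
    also have "\<dots> = ennreal (expect R (log_loss \<pi>))"
      using supp nn by (intro nn_integral_eq_integral integrable_measure_pmf_finite finite_coupling[OF R] fin)
        (auto simp: AE_measure_pmf_iff)
    finally show "(\<integral>\<^sup>+z. log_cost \<pi> z \<partial>measure_pmf R) = ennreal (expect R (log_loss \<pi>))" .
    show "0 \<le> expect R (log_loss \<pi>)"
      using supp nn by (intro integral_nonneg_AE) (auto simp: AE_measure_pmf_iff)
  qed
  have "max_transport (log_cost \<pi>) P Q = (\<Squnion>R\<in>couplings P Q. ennreal (expect R (log_loss \<pi>)))"
    unfolding max_transport_def using R(1) by (intro SUP_cong) auto
  also have "\<dots> = ennreal (transport (log_loss \<pi>) P Q)"
  proof (rule antisym)
    show "(\<Squnion>R\<in>couplings P Q. ennreal (expect R (log_loss \<pi>))) \<le> ennreal (transport (log_loss \<pi>) P Q)"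
      using fin by (intro SUP_least ennreal_leI transport_ge)
    \<comment> \<open>Near-maximal couplings carry the real supremum over to the extended
      one.\<close>
    show "ennreal (transport (log_loss \<pi>) P Q) \<le> (\<Squnion>R\<in>couplings P Q. ennreal (expect R (log_loss \<pi>)))"
    proof (rule ennreal_le_epsilon)
      fix e :: real assume e: "0 < e"
      obtain R where R': "R \<in> couplings P Q" "transport (log_loss \<pi>) P Q \<le> expect R (log_loss \<pi>) + e"
        using e by (rule near_maximal_coupling)
      have "ennreal (transport (log_loss \<pi>) P Q) \<le> ennreal (expect R (log_loss \<pi>)) + ennreal e"
        using R'(2) R(2)[OF R'(1)] e by (simp flip: ennreal_plus)
      also have "\<dots> \<le> (\<Squnion>R\<in>couplings P Q. ennreal (expect R (log_loss \<pi>))) + ennreal e"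
        using R'(1) by (intro add_right_mono SUP_upper)
      finally show "ennreal (transport (log_loss \<pi>) P Q) \<le> \<dots>" .
    qed
  qed
  finally have "max_transport (log_cost \<pi>) P Q = ennreal (transport (log_loss \<pi>) P Q)" .
  moreover have "0 \<le> transport (log_loss \<pi>) P Q"
    using transport_ge[OF fin pair_in_couplings] R(2)[OF pair_in_couplings] by (rule order_trans[rotated])
  ultimately show ?thesis by (simp add: Phi_def phi_def)
qed

subsection \<open>Decompositions of a bivariate source\<close>

text \<open>The auxiliary variable may have any type here, so that pairs such as (W, Y2) qualify;
  \<open>in_regionI\<close> returns to \<open>nat\<close>.\<close>

definition decomposition ::
    "('a \<times> 'b) pmf \<Rightarrow> 'w pmf \<Rightarrow> ('w \<Rightarrow> 'a pmf) \<Rightarrow> ('w \<Rightarrow> 'b pmf) \<Rightarrow> bool" where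
  "decomposition \<pi> p K L \<longleftrightarrow> finite (set_pmf p) \<and> bind_pmf p (\<lambda>w. pair_pmf (K w) (L w)) = \<pi>"

text \<open>For a decomposition this is I(W; X), written as H(X) - H(X|W).\<close>

definition info_rate :: "('a::countable \<times> 'b) pmf \<Rightarrow> 'w pmf \<Rightarrow> ('w \<Rightarrow> 'a pmf) \<Rightarrow> real" where
  "info_rate \<pi> p K = entropy_nats (map_pmf fst \<pi>) - expect p (\<lambda>w. entropy_nats (K w))"

definition phi_rate :: "('a::countable \<times> 'b::countable) pmf \<Rightarrow> 'w pmf \<Rightarrow>
    ('w \<Rightarrow> 'a pmf) \<Rightarrow> ('w \<Rightarrow> 'b pmf) \<Rightarrow> real" where
  "phi_rate \<pi> p K L = expect p (\<lambda>w. phi \<pi> (K w) (L w))"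

text \<open>Each conditional product law is a component of the mixture \<pi>, so its support lies in
  that of \<pi>. This keeps all costs finite and all alphabets finite.\<close>

lemma decompositionD:
  assumes "decomposition \<pi> p K L" "finite (set_pmf \<pi>)"
  shows "finite (set_pmf p)" "bind_pmf p (\<lambda>w. pair_pmf (K w) (L w)) = \<pi>"
    "\<And>w. w \<in> set_pmf p \<Longrightarrow> finite (set_pmf (K w))"
    "\<And>w. w \<in> set_pmf p \<Longrightarrow> finite (set_pmf (L w))"
    "\<And>w. w \<in> set_pmf p \<Longrightarrow> set_pmf (K w) \<times> set_pmf (L w) \<subseteq> set_pmf \<pi>"
    "map_pmf fst \<pi> = bind_pmf p K"
proof -
  show "finite (set_pmf p)" and \<pi>: "bind_pmf p (\<lambda>w. pair_pmf (K w) (L w)) = \<pi>"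
    using assms(1) by (auto simp: decomposition_def)
  show sub: "\<And>w. w \<in> set_pmf p \<Longrightarrow> set_pmf (K w) \<times> set_pmf (L w) \<subseteq> set_pmf \<pi>"
    unfolding \<pi>[symmetric] by auto
  show "map_pmf fst \<pi> = bind_pmf p K"
    unfolding \<pi>[symmetric] by (simp add: map_bind_pmf map_fst_pair_pmf)
  fix w assume "w \<in> set_pmf p"
  then have "finite (set_pmf (K w) \<times> set_pmf (L w))" using sub assms(2) by (metis finite_subset)
  then show "finite (set_pmf (K w))" "finite (set_pmf (L w))"
    by (auto simp: finite_cartesian_product_iff set_pmf_not_empty)
qed

lemma info_rate_nonneg:
  assumes "decomposition \<pi> p K L" "finite (set_pmf \<pi>)"
  shows "0 \<le> info_rate \<pi> p K"
  using decompositionD[OF assms] by (simp add: info_rate_def entropy_nats_bind_ge)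

text \<open>Evaluating the transport cost at the independent coupling bounds \<open>phi_rate\<close> from below
  by \<open>I(W; X, Y)\<close>.\<close>

lemma phi_rate_nonneg:
  assumes "decomposition \<pi> p K L" "finite (set_pmf \<pi>)"
  shows "0 \<le> phi_rate \<pi> p K L"
proof -
  note D = decompositionD[OF assms]
  let ?Z = "\<lambda>w. pair_pmf (K w) (L w)"
  have "0 \<le> entropy_nats (bind_pmf p ?Z) - expect p (\<lambda>w. entropy_nats (?Z w))"
    using D(1,3,4) by (simp add: entropy_nats_bind_ge)
  \<comment> \<open>The entropy of \<pi> is its own expected log loss, which can be averaged over
    w.\<close>
  also have "entropy_nats (bind_pmf p ?Z) = expect (bind_pmf p ?Z) (log_loss \<pi>)"
    using assms(2) unfolding D(2) by (simp add: entropy_nats_eq_expect log_loss_def[abs_def])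
  also have "\<dots> = expect p (\<lambda>w. expect (?Z w) (log_loss \<pi>))"
    using D(1,3,4) by (intro expect_bind) auto
  also have "\<dots> - expect p (\<lambda>w. entropy_nats (?Z w))
      = expect p (\<lambda>w. expect (?Z w) (log_loss \<pi>) - entropy_nats (?Z w))"
    using D(1) by (simp add: expect_diff)
  also have "\<dots> \<le> expect p (\<lambda>w. phi \<pi> (K w) (L w))"
  proof (rule expect_mono[OF D(1)])
    fix w assume "w \<in> set_pmf p"
    then show "expect (?Z w) (log_loss \<pi>) - entropy_nats (?Z w) \<le> phi \<pi> (K w) (L w)"
      using transport_ge[OF D(3,4) pair_in_couplings, of w w "log_loss \<pi>"] D(3,4)
      by (simp add: phi_def entropy_nats_pair)
  qed
  finally show ?thesis by (simp add: phi_rate_def)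
qed

text \<open>The sign constraints in \<open>region\<close> are automatic because both rates are
  nonnegative, and the extended-real sum is a finite real by \<open>Phi_eq_phi\<close>.\<close>

lemma region_iff:
  assumes fin: "finite (set_pmf \<pi>)"
  shows "(a, r) \<in> region \<pi> \<longleftrightarrow>
    (\<exists>(p :: nat pmf) K L. decomposition \<pi> p K L \<and> phi_rate \<pi> p K L \<le> a \<and> info_rate \<pi> p K \<le> r)"
proof -
  have I: "mutual_information_nats (markov_joint p K L) fst (\<lambda>(w, x, y). x) = info_rate \<pi> p K"
    and S: "(\<Sum>w\<in>set_pmf p. ereal (pmf p w) * Phi (log_cost \<pi>) (K w) (L w)) = ereal (phi_rate \<pi> p K L)"
    if "decomposition \<pi> p K L" for p :: "nat pmf" and K L
  proof -
    note D = decompositionD[OF that fin]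
    show "mutual_information_nats (markov_joint p K L) fst (\<lambda>(w, x, y). x) = info_rate \<pi> p K"
      using D by (simp add: mutual_information_markov_joint info_rate_def)
    have "(\<Sum>w\<in>set_pmf p. ereal (pmf p w) * Phi (log_cost \<pi>) (K w) (L w))
        = (\<Sum>w\<in>set_pmf p. ereal (pmf p w * phi \<pi> (K w) (L w)))"
      using D by (intro sum.cong) (auto simp: Phi_eq_phi)
    then show "(\<Sum>w\<in>set_pmf p. ereal (pmf p w) * Phi (log_cost \<pi>) (K w) (L w)) = ereal (phi_rate \<pi> p K L)"
      using D by (simp add: phi_rate_def expect_eq_sum)
  qed
  have dec: "finite (set_pmf p) \<and> map_pmf snd (markov_joint p K L) = \<pi> \<longleftrightarrow> decomposition \<pi> p K L"
    for p :: "nat pmf" and K L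
    by (simp add: decomposition_def map_snd_markov_joint)
  show ?thesis
  proof
    assume "(a, r) \<in> region \<pi>"
    then show "\<exists>(p :: nat pmf) K L. decomposition \<pi> p K L \<and> phi_rate \<pi> p K L \<le> a \<and> info_rate \<pi> p K \<le> r"
      unfolding region_def using dec I S by fastforce
  next
    assume "\<exists>(p :: nat pmf) K L. decomposition \<pi> p K L \<and> phi_rate \<pi> p K L \<le> a \<and> info_rate \<pi> p K \<le> r"
    then obtain p :: "nat pmf" and K L where
      *: "decomposition \<pi> p K L" "phi_rate \<pi> p K L \<le> a" "info_rate \<pi> p K \<le> r" by blast
    have "0 \<le> a" "0 \<le> r"
      using * phi_rate_nonneg[OF *(1) fin] info_rate_nonneg[OF *(1) fin] by linarith+
    then show "(a, r) \<in> region \<pi>"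
      unfolding region_def using * dec[of p K L] I[OF *(1)] S[OF *(1)]
      by (auto intro!: exI[of _ p] exI[of _ K] exI[of _ L])
  qed
qed

text \<open>Encoding a countable auxiliary alphabet into \<open>nat\<close>, with kernels that
  decode first, changes neither rate.\<close>

lemma in_regionI:
  fixes p :: "'w::countable pmf"
  assumes fin: "finite (set_pmf \<pi>)" and "decomposition \<pi> p K L"
    and "phi_rate \<pi> p K L \<le> a" "info_rate \<pi> p K \<le> r"
  shows "(a, r) \<in> region \<pi>"
  unfolding region_iff[OF fin]
proof (intro exI conjI)
  let ?p = "map_pmf to_nat p" and ?K = "\<lambda>i. K (from_nat i)" and ?L = "\<lambda>i. L (from_nat i)"
  show "decomposition \<pi> ?p ?K ?L"
    using assms(2) by (auto simp: decomposition_def bind_map_pmf)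
  show "phi_rate \<pi> ?p ?K ?L \<le> a" "info_rate \<pi> ?p ?K \<le> r"
    using assms(3,4) by (simp_all add: phi_rate_def info_rate_def)
qed

subsection \<open>Relabelling\<close>

text \<open>A coupling of the image laws pulls back along the inverse maps to a coupling of
  \<open>P\<close> and \<open>Q\<close> with the same expected loss. Injectivity on \<open>A\<close>
  and \<open>B\<close> alone is assumed so that the bound also covers inverse relabellings, which
  are injective only on a range.\<close>

lemma phi_map_le:
  assumes inj: "inj_on f A" "inj_on g B" and \<pi>: "set_pmf \<pi> \<subseteq> A \<times> B"
    and sub: "set_pmf P \<times> set_pmf Q \<subseteq> set_pmf \<pi>" and fin: "finite (set_pmf P)" "finite (set_pmf Q)"
  shows "phi (map_pmf (map_prod f g) \<pi>) (map_pmf f P) (map_pmf g Q) \<le> phi \<pi> P Q"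
proof -
  let ?\<pi> = "map_pmf (map_prod f g) \<pi>" and ?h = "map_prod (inv_into A f) (inv_into B g)"
  have AB: "set_pmf P \<subseteq> A" "set_pmf Q \<subseteq> B"
    using sub \<pi> set_pmf_not_empty[of P] set_pmf_not_empty[of Q] by blast+
  have "inj_on (map_prod f g) (A \<times> B)" using inj by (rule map_prod_inj_on)
  then have injp: "inj_on (map_prod f g) (set_pmf \<pi>)" using \<pi> by (rule inj_on_subset)
  have "transport (log_loss ?\<pi>) (map_pmf f P) (map_pmf g Q) \<le> transport (log_loss \<pi>) P Q"
  proof (rule transport_le)
    fix R assume R: "R \<in> couplings (map_pmf f P) (map_pmf g Q)"
    have marg: "map_pmf fst R = map_pmf f P" "map_pmf snd R = map_pmf g Q"
      using R by (auto simp: couplings_def)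
    have "map_pmf fst (map_pmf ?h R) = map_pmf (inv_into A f) (map_pmf fst R)"
      "map_pmf snd (map_pmf ?h R) = map_pmf (inv_into B g) (map_pmf snd R)"
      by (simp_all add: map_pmf_comp)
    moreover have "map_pmf (inv_into A f) (map_pmf f P) = P" "map_pmf (inv_into B g) (map_pmf g Q) = Q"
      unfolding map_pmf_comp using inj AB by (auto intro!: pmf.map_ident_strong simp: inv_into_f_f subset_iff)
    ultimately have hR: "map_pmf ?h R \<in> couplings P Q"
      by (simp add: couplings_def marg)
    have "expect R (log_loss ?\<pi>) = expect R (\<lambda>z. log_loss \<pi> (?h z))"
    proof (rule expect_cong)
      fix z assume "z \<in> set_pmf R"
      then obtain x y where z: "z = map_prod f g (x, y)" and xy: "x \<in> set_pmf P" "y \<in> set_pmf Q"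
        using set_pmf_coupling[OF R] by auto
      then have "?h z = (x, y)" using inj AB by (auto simp: inv_into_f_f subset_iff)
      moreover have "(x, y) \<in> set_pmf \<pi>" using xy sub by blast
      ultimately show "log_loss ?\<pi> z = log_loss \<pi> (?h z)"
        using pmf_map_inj[OF injp] by (simp add: log_loss_def z del: map_prod_simp)
    qed
    also have "\<dots> \<le> transport (log_loss \<pi>) P Q"
      using transport_ge[OF fin hR] by simp
    finally show "expect R (log_loss ?\<pi>) \<le> transport (log_loss \<pi>) P Q" .
  qed
  moreover have "entropy_nats (map_pmf f P) = entropy_nats P" "entropy_nats (map_pmf g Q) = entropy_nats Q"
    using inj AB fin by (auto intro!: entropy_nats_map_inj intro: inj_on_subset)
  ultimately show ?thesis by (simp add: phi_def)
qed

text \<open>The auxiliary variable is kept and only the kernels are pushed forward.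
  \<open>region_map\<close> obtains the reverse inclusion by applying this to the inverse
  maps.\<close>

lemma region_map_subset:
  assumes inj: "inj_on f A" "inj_on g B" and \<pi>: "set_pmf \<pi> \<subseteq> A \<times> B" and fin: "finite (set_pmf \<pi>)"
  shows "region \<pi> \<subseteq> region (map_pmf (map_prod f g) \<pi>)"
proof clarify
  let ?\<pi> = "map_pmf (map_prod f g) \<pi>"
  fix a r assume "(a, r) \<in> region \<pi>"
  then obtain p :: "nat pmf" and K L where
    *: "decomposition \<pi> p K L" "phi_rate \<pi> p K L \<le> a" "info_rate \<pi> p K \<le> r"
    using region_iff[OF fin] by blast
  note D = decompositionD[OF *(1) fin]
  let ?K = "\<lambda>w. map_pmf f (K w)" and ?L = "\<lambda>w. map_pmf g (L w)"
  have KA: "set_pmf (K w) \<subseteq> A" if "w \<in> set_pmf p" for w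
    using D(5)[OF that] \<pi> set_pmf_not_empty[of "L w"] by blast
  show "(a, r) \<in> region ?\<pi>"
  proof (rule in_regionI)
    show "finite (set_pmf ?\<pi>)" using fin by simp
    have "bind_pmf p (\<lambda>w. pair_pmf (?K w) (?L w)) = map_pmf (map_prod f g) (bind_pmf p (\<lambda>w. pair_pmf (K w) (L w)))"
      by (simp add: map_bind_pmf map_pair[symmetric] map_prod_def)
    then show "decomposition ?\<pi> p ?K ?L" using D(1,2) by (simp add: decomposition_def)
    have "phi_rate ?\<pi> p ?K ?L \<le> phi_rate \<pi> p K L"
      unfolding phi_rate_def using D by (intro expect_mono phi_map_le[OF inj \<pi>])
    then show "phi_rate ?\<pi> p ?K ?L \<le> a" using *(2) by simp
    have "entropy_nats (map_pmf fst ?\<pi>) = entropy_nats (map_pmf f (map_pmf fst \<pi>))"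
      by (simp add: map_pmf_comp)
    also have "\<dots> = entropy_nats (map_pmf fst \<pi>)"
      using fin \<pi> by (intro entropy_nats_map_inj) (auto intro!: inj_on_subset[OF inj(1)])
    moreover have "expect p (\<lambda>w. entropy_nats (?K w)) = expect p (\<lambda>w. entropy_nats (K w))"
      using D(3) KA by (intro expect_cong entropy_nats_map_inj) (auto intro: inj_on_subset[OF inj(1)])
    ultimately show "info_rate ?\<pi> p ?K \<le> r" using *(3) by (simp add: info_rate_def)
  qed
qed

lemma region_map:
  assumes "inj f" "inj g" and fin: "finite (set_pmf \<pi>)"
  shows "region (map_pmf (map_prod f g) \<pi>) = region \<pi>"
proof
  show "region \<pi> \<subseteq> region (map_pmf (map_prod f g) \<pi>)"
    using assms by (intro region_map_subset) auto
  have "region (map_pmf (map_prod f g) \<pi>)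
      \<subseteq> region (map_pmf (map_prod (inv f) (inv g)) (map_pmf (map_prod f g) \<pi>))"
    using fin by (intro region_map_subset[of _ "range f" _ "range g"] inj_on_inv_into) auto
  also have "map_pmf (map_prod (inv f) (inv g)) (map_pmf (map_prod f g) \<pi>) = \<pi>"
    unfolding map_pmf_comp using assms by (intro pmf.map_ident_strong) (auto simp: inv_f_f)
  finally show "region (map_pmf (map_prod f g) \<pi>) \<subseteq> region \<pi>" .
qed

subsection \<open>Convexity\<close>

text \<open>Time sharing: a Bernoulli tag, recorded in the auxiliary variable, selects one of the
  two decompositions.\<close>

lemma region_convex:
  assumes fin: "finite (set_pmf \<pi>)" and mem: "z1 \<in> region \<pi>" "z2 \<in> region \<pi>" and t: "0 \<le> t" "t \<le> 1"
  shows "t *\<^sub>R z1 + (1 - t) *\<^sub>R z2 \<in> region \<pi>"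
proof -
  obtain a1 r1 a2 r2 where z: "z1 = (a1, r1)" "z2 = (a2, r2)" by (metis surj_pair)
  obtain p1 :: "nat pmf" and K1 L1 where
    1: "decomposition \<pi> p1 K1 L1" "phi_rate \<pi> p1 K1 L1 \<le> a1" "info_rate \<pi> p1 K1 \<le> r1"
    using mem(1) region_iff[OF fin] z by blast
  obtain p2 :: "nat pmf" and K2 L2 where
    2: "decomposition \<pi> p2 K2 L2" "phi_rate \<pi> p2 K2 L2 \<le> a2" "info_rate \<pi> p2 K2 \<le> r2"
    using mem(2) region_iff[OF fin] z by blast
  note D1 = decompositionD[OF 1(1) fin] and D2 = decompositionD[OF 2(1) fin]
  let ?p = "bind_pmf (bernoulli_pmf t) (\<lambda>b. map_pmf (Pair b) (if b then p1 else p2))"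
  let ?K = "\<lambda>(b, w). if b then K1 w else K2 w" and ?L = "\<lambda>(b, w). if b then L1 w else L2 w"
  have E: "expect ?p f = t * expect p1 (\<lambda>w. f (True, w)) + (1 - t) * expect p2 (\<lambda>w. f (False, w))" for f
    using D1(1) D2(1) t by (subst expect_bind) (auto simp: mult.commute)
  have "bind_pmf ?p (\<lambda>w. pair_pmf (?K w) (?L w)) = bind_pmf (bernoulli_pmf t)
      (\<lambda>b. if b then bind_pmf p1 (\<lambda>w. pair_pmf (K1 w) (L1 w)) else bind_pmf p2 (\<lambda>w. pair_pmf (K2 w) (L2 w)))"
    by (auto simp: bind_assoc_pmf bind_map_pmf intro!: bind_pmf_cong)
  also have "\<dots> = \<pi>" by (simp only: D1(2) D2(2) if_cancel bind_pmf_const)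
  finally have dec: "decomposition \<pi> ?p ?K ?L"
    using D1(1) D2(1) by (simp add: decomposition_def)
  have "phi_rate \<pi> ?p ?K ?L = t * phi_rate \<pi> p1 K1 L1 + (1 - t) * phi_rate \<pi> p2 K2 L2"
    by (simp add: phi_rate_def E)
  also have "\<dots> \<le> t * a1 + (1 - t) * a2"
    using 1(2) 2(2) t by (intro add_mono mult_left_mono) auto
  finally have phi: "phi_rate \<pi> ?p ?K ?L \<le> t * a1 + (1 - t) * a2" .
  \<comment> \<open>Both decompositions have the same source \<pi>, so the term H(X) enters with
    total weight t + (1 - t) = 1.\<close>
  have "info_rate \<pi> ?p ?K = t * info_rate \<pi> p1 K1 + (1 - t) * info_rate \<pi> p2 K2"
    by (simp add: info_rate_def E algebra_simps)
  also have "\<dots> \<le> t * r1 + (1 - t) * r2"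
    using 1(3) 2(3) t by (intro add_mono mult_left_mono) auto
  finally show ?thesis
    using in_regionI[OF fin dec phi] z by simp
qed

subsection \<open>Product sources\<close>

lemma finite_product_source:
  "finite (set_pmf \<pi>1) \<Longrightarrow> finite (set_pmf \<pi>2) \<Longrightarrow> finite (set_pmf (product_source \<pi>1 \<pi>2))"
  by (simp add: product_source_def)

lemma mem_product_source:
  "((x1, x2), (y1, y2)) \<in> set_pmf (product_source \<pi>1 \<pi>2) \<longleftrightarrow>
    (x1, y1) \<in> set_pmf \<pi>1 \<and> (x2, y2) \<in> set_pmf \<pi>2"
  by (force simp: product_source_def image_iff)

text \<open>Additivity is confined to the support: where one factor vanishes, the convention
  \<open>ln 0 = 0\<close> can break it.\<close>

lemma log_loss_product:
  assumes "z \<in> set_pmf (product_source \<pi>1 \<pi>2)"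
  shows "log_loss (product_source \<pi>1 \<pi>2) z
    = log_loss \<pi>1 (map_prod fst fst z) + log_loss \<pi>2 (map_prod snd snd z)"
proof -
  obtain x1 x2 y1 y2 where z: "z = ((x1, x2), (y1, y2))" by (metis surj_pair)
  then have "0 < pmf \<pi>1 (x1, y1)" "0 < pmf \<pi>2 (x2, y2)"
    using assms by (auto simp: mem_product_source pmf_positive)
  then show ?thesis by (simp add: z log_loss_def pmf_product_source ln_mult)
qed

lemma product_source_marginals:
  "map_pmf (map_prod fst fst) (product_source \<pi>1 \<pi>2) = \<pi>1"
  "map_pmf (map_prod snd snd) (product_source \<pi>1 \<pi>2) = \<pi>2"
  "map_pmf fst (product_source \<pi>1 \<pi>2) = pair_pmf (map_pmf fst \<pi>1) (map_pmf fst \<pi>2)"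
  by (simp_all add: product_source_def map_pmf_comp split_beta map_fst_pair_pmf map_snd_pair_pmf
      flip: map_pair[unfolded split_beta])

text \<open>By additivity, the expected loss of a coupling depends only on the joint laws of its
  first and of its second coordinates; this serves both inclusions.\<close>

lemma expect_log_loss_product:
  assumes "finite (set_pmf R)" "set_pmf R \<subseteq> set_pmf (product_source \<pi>1 \<pi>2)"
  shows "expect R (log_loss (product_source \<pi>1 \<pi>2))
    = expect (map_pmf (map_prod fst fst) R) (log_loss \<pi>1) + expect (map_pmf (map_prod snd snd) R) (log_loss \<pi>2)"
proof -
  have "expect R (log_loss (product_source \<pi>1 \<pi>2))
      = expect R (\<lambda>z. log_loss \<pi>1 (map_prod fst fst z) + log_loss \<pi>2 (map_prod snd snd z))"
    using assms(2) by (intro expect_cong log_loss_product) auto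
  then show ?thesis using assms(1) by (simp add: expect_add)
qed

text \<open>Both coordinate projections of a coupling of product laws are couplings of the factors,
  and the entropies of independent pairs add exactly.\<close>

lemma phi_product_le:
  assumes fin: "finite (set_pmf P1)" "finite (set_pmf P2)" "finite (set_pmf Q1)" "finite (set_pmf Q2)"
    and sub: "set_pmf P1 \<times> set_pmf Q1 \<subseteq> set_pmf \<pi>1" "set_pmf P2 \<times> set_pmf Q2 \<subseteq> set_pmf \<pi>2"
  shows "phi (product_source \<pi>1 \<pi>2) (pair_pmf P1 P2) (pair_pmf Q1 Q2) \<le> phi \<pi>1 P1 Q1 + phi \<pi>2 P2 Q2"
proof -
  have "transport (log_loss (product_source \<pi>1 \<pi>2)) (pair_pmf P1 P2) (pair_pmf Q1 Q2)
      \<le> transport (log_loss \<pi>1) P1 Q1 + transport (log_loss \<pi>2) P2 Q2"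
  proof (rule transport_le)
    fix R assume R: "R \<in> couplings (pair_pmf P1 P2) (pair_pmf Q1 Q2)"
    have "map_pmf fst (map_pmf (map_prod fst fst) R) = map_pmf fst (map_pmf fst R)"
      "map_pmf snd (map_pmf (map_prod fst fst) R) = map_pmf fst (map_pmf snd R)"
      "map_pmf fst (map_pmf (map_prod snd snd) R) = map_pmf snd (map_pmf fst R)"
      "map_pmf snd (map_pmf (map_prod snd snd) R) = map_pmf snd (map_pmf snd R)"
      by (simp_all add: map_pmf_comp)
    then have R': "map_pmf (map_prod fst fst) R \<in> couplings P1 Q1" "map_pmf (map_prod snd snd) R \<in> couplings P2 Q2"
      using R by (simp_all add: couplings_def map_fst_pair_pmf map_snd_pair_pmf)
    have "set_pmf R \<subseteq> set_pmf (product_source \<pi>1 \<pi>2)"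
      using set_pmf_coupling[OF R] sub by (auto simp: mem_product_source subset_iff)
    then have "expect R (log_loss (product_source \<pi>1 \<pi>2))
      = expect (map_pmf (map_prod fst fst) R) (log_loss \<pi>1) + expect (map_pmf (map_prod snd snd) R) (log_loss \<pi>2)"
      using fin by (intro expect_log_loss_product finite_coupling[OF R]) auto
    also have "\<dots> \<le> transport (log_loss \<pi>1) P1 Q1 + transport (log_loss \<pi>2) P2 Q2"
      using fin R' by (intro add_mono transport_ge)
    finally show "expect R (log_loss (product_source \<pi>1 \<pi>2)) \<le> \<dots>" .
  qed
  then show ?thesis using fin by (simp add: phi_def entropy_nats_pair)
qed

lemma region_add_subset:
  fixes \<pi>1 :: "('a::countable \<times> 'b::countable) pmf" and \<pi>2 :: "('c::countable \<times> 'd::countable) pmf"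
  assumes fin: "finite (set_pmf \<pi>1)" "finite (set_pmf \<pi>2)" and mem: "(a1, r1) \<in> region \<pi>1" "(a2, r2) \<in> region \<pi>2"
  shows "(a1 + a2, r1 + r2) \<in> region (product_source \<pi>1 \<pi>2)"
proof -
  obtain p1 :: "nat pmf" and K1 L1 where
    1: "decomposition \<pi>1 p1 K1 L1" "phi_rate \<pi>1 p1 K1 L1 \<le> a1" "info_rate \<pi>1 p1 K1 \<le> r1"
    using mem(1) region_iff[OF fin(1)] by blast
  obtain p2 :: "nat pmf" and K2 L2 where
    2: "decomposition \<pi>2 p2 K2 L2" "phi_rate \<pi>2 p2 K2 L2 \<le> a2" "info_rate \<pi>2 p2 K2 \<le> r2"
    using mem(2) region_iff[OF fin(2)] by blast
  note D1 = decompositionD[OF 1(1) fin(1)] and D2 = decompositionD[OF 2(1) fin(2)]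
  let ?\<pi> = "product_source \<pi>1 \<pi>2" and ?p = "pair_pmf p1 p2"
  let ?K = "\<lambda>(w1, w2). pair_pmf (K1 w1) (K2 w2)" and ?L = "\<lambda>(w1, w2). pair_pmf (L1 w1) (L2 w2)"
  show ?thesis
  proof (rule in_regionI)
    show "finite (set_pmf ?\<pi>)" using fin by (rule finite_product_source)
    have "bind_pmf ?p (\<lambda>w. pair_pmf (?K w) (?L w)) = bind_pmf p1 (\<lambda>w1. bind_pmf p2 (\<lambda>w2.
        bind_pmf (K1 w1) (\<lambda>x1. bind_pmf (K2 w2) (\<lambda>x2. bind_pmf (L1 w1) (\<lambda>y1. bind_pmf (L2 w2) (\<lambda>y2.
          return_pmf ((x1, x2), (y1, y2))))))))"
      by (simp add: pair_pmf_def bind_assoc_pmf bind_return_pmf)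
    \<comment> \<open>Independent draws commute; the next steps reorder them until w1, x1, y1 all
      precede w2, x2, y2.\<close>
    also have "\<dots> = bind_pmf p1 (\<lambda>w1. bind_pmf (K1 w1) (\<lambda>x1. bind_pmf p2 (\<lambda>w2. bind_pmf (L1 w1) (\<lambda>y1. 
        bind_pmf (K2 w2) (\<lambda>x2. bind_pmf (L2 w2) (\<lambda>y2. return_pmf ((x1, x2), (y1, y2))))))))"
      by (subst bind_commute_pmf[of p2], subst bind_commute_pmf[of "L1 _"]) rule
    also have "\<dots> = bind_pmf p1 (\<lambda>w1. bind_pmf (K1 w1) (\<lambda>x1. bind_pmf (L1 w1) (\<lambda>y1. bind_pmf p2 (\<lambda>w2.
        bind_pmf (K2 w2) (\<lambda>x2. bind_pmf (L2 w2) (\<lambda>y2. return_pmf ((x1, x2), (y1, y2))))))))"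
      by (subst bind_commute_pmf[of p2]) rule
    also have "\<dots> = ?\<pi>"
      by (simp add: product_source_def map_bind_pmf bind_map_pmf pair_pmf_def bind_assoc_pmf bind_return_pmf
          flip: D1(2) D2(2))
    finally show "decomposition ?\<pi> ?p ?K ?L" using D1(1) D2(1) by (simp add: decomposition_def)
    have "phi_rate ?\<pi> ?p ?K ?L \<le> expect ?p (\<lambda>(w1, w2). phi \<pi>1 (K1 w1) (L1 w1) + phi \<pi>2 (K2 w2) (L2 w2))"
      unfolding phi_rate_def using D1 D2 by (intro expect_mono) (auto intro!: phi_product_le)
    also have "\<dots> = phi_rate \<pi>1 p1 K1 L1 + phi_rate \<pi>2 p2 K2 L2"
      using D1 D2 by (simp add: expect_pair_add phi_rate_def)
    finally show "phi_rate ?\<pi> ?p ?K ?L \<le> a1 + a2" using 1(2) 2(2) by linarith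
    have "expect ?p (\<lambda>w. entropy_nats (?K w)) = expect ?p (\<lambda>(w1, w2). entropy_nats (K1 w1) + entropy_nats (K2 w2))"
      using D1 D2 by (intro expect_cong) (auto simp: entropy_nats_pair)
    also have "\<dots> = expect p1 (\<lambda>w. entropy_nats (K1 w)) + expect p2 (\<lambda>w. entropy_nats (K2 w))"
      using D1 D2 by (simp add: expect_pair_add)
    finally have "info_rate ?\<pi> ?p ?K = info_rate \<pi>1 p1 K1 + info_rate \<pi>2 p2 K2"
      using fin by (simp add: info_rate_def product_source_marginals entropy_nats_pair)
    then show "info_rate ?\<pi> ?p ?K \<le> r1 + r2" using 1(3) 2(3) by linarith
  qed
qed

subsection \<open>Splitting the auxiliary variable\<close>

lemma pair_bind_pmf_right: "pair_pmf p (bind_pmf q f) = bind_pmf q (\<lambda>y. pair_pmf p (f y))"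
  unfolding pair_pmf_def bind_assoc_pmf by (rule bind_commute_pmf)

lemma pair_bind_pmf_left: "pair_pmf (bind_pmf q f) p = bind_pmf q (\<lambda>y. pair_pmf (f y) p)"
  by (simp add: pair_pmf_def bind_assoc_pmf)

lemma map_fst_pair_pmf_comp: "map_pmf (\<lambda>z. f (fst z)) (pair_pmf p q) = map_pmf f p"
  by (simp flip: map_pmf_comp add: map_fst_pair_pmf)

lemma map_snd_pair_pmf_comp: "map_pmf (\<lambda>z. f (snd z)) (pair_pmf p q) = map_pmf f q"
  by (simp flip: map_pmf_comp add: map_snd_pair_pmf)

text \<open>In the glued law \<open>x\<^sub>1\<close> and \<open>y\<^sub>2\<close> are independent, which is what makes the two families
  of couplings compatible: both induce the law \<open>P\<^sub>1 \<otimes> Q\<^sub>2\<close> on \<open>(x\<^sub>1, y\<^sub>2)\<close>.\<close>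

lemma glue_couplings:
  assumes P: "P = bind_pmf P1 (\<lambda>x1. map_pmf (Pair x1) (C x1))"
    and Q: "Q = bind_pmf Q2 (\<lambda>y2. map_pmf (\<lambda>y1. (y1, y2)) (D y2))"
    and R1: "\<And>y2. R1 y2 \<in> couplings P1 (D y2)" and R2: "\<And>x1. R2 x1 \<in> couplings (C x1) Q2"
  obtains R where "R \<in> couplings P Q"
    "map_pmf (map_prod fst fst) R = bind_pmf Q2 R1" "map_pmf (map_prod snd snd) R = bind_pmf P1 R2"
proof -
  have "\<exists>E. R1 y2 = bind_pmf P1 (\<lambda>x1. map_pmf (Pair x1) (E x1))" for y2
    using R1[of y2] disintegrate_fst[of "R1 y2"] by (auto simp: couplings_def)
  then obtain E where E: "\<And>y2. R1 y2 = bind_pmf P1 (\<lambda>x1. map_pmf (Pair x1) (E y2 x1))" by metis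
  have "\<exists>F. R2 x1 = bind_pmf Q2 (\<lambda>y2. map_pmf (\<lambda>x2. (x2, y2)) (F y2))" for x1
    using R2[of x1] disintegrate_snd[of "R2 x1"] by (auto simp: couplings_def)
  then obtain F where F: "\<And>x1. R2 x1 = bind_pmf Q2 (\<lambda>y2. map_pmf (\<lambda>x2. (x2, y2)) (F x1 y2))" by metis
  \<comment> \<open>Draw x1 and y2 independently, then y1 from the conditional law of
    \<open>R1 y2\<close> given x1 and, independently of y1, x2 from that of \<open>R2 x1\<close>
    given y2.\<close>
  define R where "R = bind_pmf P1 (\<lambda>x1. bind_pmf Q2 (\<lambda>y2.
    map_pmf (\<lambda>(y1, x2). ((x1, x2), (y1, y2))) (pair_pmf (E y2 x1) (F x1 y2))))"
  \<comment> \<open>Both orders of drawing are needed: x1 is outermost in \<open>P\<close> and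
    \<open>bind_pmf P1 R2\<close>, y2 in \<open>Q\<close> and \<open>bind_pmf Q2 R1\<close>.\<close>
  have swap: "R = bind_pmf Q2 (\<lambda>y2. bind_pmf P1 (\<lambda>x1.
    map_pmf (\<lambda>(y1, x2). ((x1, x2), (y1, y2))) (pair_pmf (E y2 x1) (F x1 y2))))"
    unfolding R_def by (rule bind_commute_pmf)
  show ?thesis
  proof
    \<comment> \<open>The marginal conditions on \<open>R2 x1\<close> and \<open>R1 y2\<close> say
      that averaging out the other variable restores \<open>C x1\<close> and
      \<open>D y2\<close>.\<close>
    have m1: "C x1 = bind_pmf Q2 (F x1)" for x1
      using R2[of x1] by (simp add: couplings_def F map_bind_pmf map_pmf_comp map_pmf_ident)
    have m2: "D y2 = bind_pmf P1 (E y2)" for y2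
      using R1[of y2] by (simp add: couplings_def E map_bind_pmf map_pmf_comp map_pmf_ident)
    have "map_pmf fst R = P"
      by (simp add: R_def P m1 map_bind_pmf map_pmf_comp split_beta map_snd_pair_pmf_comp[where f = "Pair _"])
    moreover have "map_pmf snd R = Q"
      by (simp add: swap Q m2 map_bind_pmf map_pmf_comp split_beta map_fst_pair_pmf_comp[where f = "\<lambda>y. (y, _)"])
    ultimately show "R \<in> couplings P Q" by (simp add: couplings_def)
    show "map_pmf (map_prod fst fst) R = bind_pmf Q2 R1"
      by (simp add: swap E[abs_def] map_bind_pmf map_pmf_comp split_beta map_fst_pair_pmf_comp[where f = "Pair _"])
    show "map_pmf (map_prod snd snd) R = bind_pmf P1 R2"
      by (simp add: R_def F[abs_def] map_bind_pmf map_pmf_comp split_beta map_snd_pair_pmf_comp[where f = "\<lambda>y. (y, _)"])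
  qed
qed

text \<open>Glued near-maximal couplings make the transport costs superadditive, while the chain
  rule, conditioning on x1 in \<open>P\<close> and on y2 in \<open>Q\<close>, splits the entropies
  with equality.\<close>

lemma phi_product_ge:
  assumes P: "P = bind_pmf P1 (\<lambda>x1. map_pmf (Pair x1) (C x1))"
    and Q: "Q = bind_pmf Q2 (\<lambda>y2. map_pmf (\<lambda>y1. (y1, y2)) (D y2))"
    and fin: "finite (set_pmf P1)" "\<And>x1. x1 \<in> set_pmf P1 \<Longrightarrow> finite (set_pmf (C x1))"
      "finite (set_pmf Q2)" "\<And>y2. y2 \<in> set_pmf Q2 \<Longrightarrow> finite (set_pmf (D y2))"
    and sub: "set_pmf P \<times> set_pmf Q \<subseteq> set_pmf (product_source \<pi>1 \<pi>2)"
  shows "expect Q2 (\<lambda>y2. phi \<pi>1 P1 (D y2)) + expect P1 (\<lambda>x1. phi \<pi>2 (C x1) Q2)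
    \<le> phi (product_source \<pi>1 \<pi>2) P Q"
proof -
  have finP: "finite (set_pmf P)" and finQ: "finite (set_pmf Q)"
    unfolding P Q using fin by auto
  let ?\<pi> = "product_source \<pi>1 \<pi>2"
  let ?T1 = "\<lambda>y2. transport (log_loss \<pi>1) P1 (D y2)" and ?T2 = "\<lambda>x1. transport (log_loss \<pi>2) (C x1) Q2"
  have "expect Q2 ?T1 + expect P1 ?T2 \<le> transport (log_loss ?\<pi>) P Q"
  proof (rule field_le_epsilon)
    fix e :: real assume "0 < e"
    then have e: "0 < e / 2" by simp
    \<comment> \<open>Each family of couplings spends half of the slack; averaging leaves a total
      loss of \<open>e\<close>.\<close>
    have "\<exists>R. R \<in> couplings P1 (D y2) \<and> ?T1 y2 \<le> expect R (log_loss \<pi>1) + e / 2" for y2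
      using near_maximal_coupling[OF e] by metis
    then obtain R1 where R1: "\<And>y2. R1 y2 \<in> couplings P1 (D y2)"
      "\<And>y2. ?T1 y2 \<le> expect (R1 y2) (log_loss \<pi>1) + e / 2" by metis
    have "\<exists>R. R \<in> couplings (C x1) Q2 \<and> ?T2 x1 \<le> expect R (log_loss \<pi>2) + e / 2" for x1
      using near_maximal_coupling[OF e] by metis
    then obtain R2 where R2: "\<And>x1. R2 x1 \<in> couplings (C x1) Q2"
      "\<And>x1. ?T2 x1 \<le> expect (R2 x1) (log_loss \<pi>2) + e / 2" by metis
    obtain R where R: "R \<in> couplings P Q"
      "map_pmf (map_prod fst fst) R = bind_pmf Q2 R1" "map_pmf (map_prod snd snd) R = bind_pmf P1 R2"
      using glue_couplings[OF P Q R1(1) R2(1)] by metis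
    have f1: "\<And>y2. y2 \<in> set_pmf Q2 \<Longrightarrow> finite (set_pmf (R1 y2))"
      and f2: "\<And>x1. x1 \<in> set_pmf P1 \<Longrightarrow> finite (set_pmf (R2 x1))"
      using fin by (auto intro: finite_coupling[OF R1(1)] finite_coupling[OF R2(1)])
    have "expect Q2 ?T1 + expect P1 ?T2
        \<le> expect Q2 (\<lambda>y2. expect (R1 y2) (log_loss \<pi>1) + e / 2) + expect P1 (\<lambda>x1. expect (R2 x1) (log_loss \<pi>2) + e / 2)"
      using fin R1(2) R2(2) by (intro add_mono expect_mono)
    also have "\<dots> = expect (bind_pmf Q2 R1) (log_loss \<pi>1) + expect (bind_pmf P1 R2) (log_loss \<pi>2) + e"
      using fin f1 f2 by (simp add: expect_add expect_bind)
    also have "\<dots> = expect R (log_loss ?\<pi>) + e"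
      using sub set_pmf_coupling[OF R(1)]
      by (subst expect_log_loss_product[OF finite_coupling[OF R(1) finP finQ]]) (auto simp: R(2,3))
    also have "\<dots> \<le> transport (log_loss ?\<pi>) P Q + e"
      using transport_ge[OF finP finQ R(1)] by simp
    finally show "expect Q2 ?T1 + expect P1 ?T2 \<le> transport (log_loss ?\<pi>) P Q + e" .
  qed
  moreover have "entropy_nats P = entropy_nats P1 + expect P1 (\<lambda>x1. entropy_nats (C x1))"
    unfolding P using fin by (intro entropy_nats_chain)
  moreover have "entropy_nats Q = entropy_nats Q2 + expect Q2 (\<lambda>y2. entropy_nats (D y2))"
  proof -
    \<comment> \<open>\<open>Q\<close> is disintegrated along its second coordinate, so it is
      swapped before the chain rule applies.\<close>
    have "map_pmf prod.swap Q = bind_pmf Q2 (\<lambda>y2. map_pmf (Pair y2) (D y2))"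
      by (simp add: Q map_bind_pmf map_pmf_comp)
    moreover have "entropy_nats (map_pmf prod.swap Q) = entropy_nats Q"
      using finQ by (intro entropy_nats_map_inj) auto
    ultimately show ?thesis using fin entropy_nats_chain[of Q2 D] by simp
  qed
  ultimately show ?thesis
    using fin by (simp add: phi_def expect_diff)
qed

text \<open>The first part uses \<open>(W, Y\<^sub>2)\<close> and the second \<open>(W, X\<^sub>1)\<close> as auxiliary variable. Since
  \<open>X\<^sub>1\<close> and \<open>Y\<^sub>2\<close> are independent given \<open>W\<close>, including \<open>Y\<^sub>2\<close> leaves \<open>I(W; X\<^sub>1)\<close> unchanged, while
  \<open>I(W, X\<^sub>1; X\<^sub>2) = I(W; X\<^sub>2 | X\<^sub>1)\<close>.\<close>

lemma decomposition_split:
  fixes \<pi>1 :: "('a::countable \<times> 'b::countable) pmf" and \<pi>2 :: "('c::countable \<times> 'd::countable) pmf"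
    and p :: "'w pmf"
  assumes fin: "finite (set_pmf \<pi>1)" "finite (set_pmf \<pi>2)"
    and dec: "decomposition (product_source \<pi>1 \<pi>2) p K L"
  obtains p1 :: "('w \<times> 'd) pmf" and K1 L1 and p2 :: "('w \<times> 'a) pmf" and K2 L2
  where "decomposition \<pi>1 p1 K1 L1" "decomposition \<pi>2 p2 K2 L2"
    "phi_rate \<pi>1 p1 K1 L1 + phi_rate \<pi>2 p2 K2 L2 \<le> phi_rate (product_source \<pi>1 \<pi>2) p K L"
    "info_rate \<pi>1 p1 K1 + info_rate \<pi>2 p2 K2 = info_rate (product_source \<pi>1 \<pi>2) p K"
proof -
  let ?\<pi> = "product_source \<pi>1 \<pi>2"
  note F = decompositionD[OF dec finite_product_source[OF fin]]
  define P1 where "P1 w = map_pmf fst (K w)" for w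
  define Q2 where "Q2 w = map_pmf snd (L w)" for w
  have "\<exists>C. K w = bind_pmf (P1 w) (\<lambda>x1. map_pmf (Pair x1) (C x1))" for w
    unfolding P1_def using disintegrate_fst by metis
  then obtain C where C: "\<And>w. K w = bind_pmf (P1 w) (\<lambda>x1. map_pmf (Pair x1) (C w x1))" by metis
  have "\<exists>D. L w = bind_pmf (Q2 w) (\<lambda>y2. map_pmf (\<lambda>y1. (y1, y2)) (D y2))" for w
    unfolding Q2_def using disintegrate_snd by metis
  then obtain D where D: "\<And>w. L w = bind_pmf (Q2 w) (\<lambda>y2. map_pmf (\<lambda>y1. (y1, y2)) (D w y2))" by metis
  have C2: "bind_pmf (P1 w) (C w) = map_pmf snd (K w)" for w
    by (subst C) (simp add: map_bind_pmf map_pmf_comp map_pmf_ident)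
  have D1: "bind_pmf (Q2 w) (D w) = map_pmf fst (L w)" for w
    by (subst D) (simp add: map_bind_pmf map_pmf_comp map_pmf_ident)
  have finP1: "finite (set_pmf (P1 w))" and finQ2: "finite (set_pmf (Q2 w))" if "w \<in> set_pmf p" for w
    using F(3,4)[OF that] by (simp_all add: P1_def Q2_def)
  \<comment> \<open>Disintegration does not control \<open>C w x1\<close> at x1 of mass zero. On the
    support of \<open>P1 w\<close> it is a component of the finitely supported marginal of
    X2.\<close>
  have finC: "finite (set_pmf (C w x1))" if "w \<in> set_pmf p" "x1 \<in> set_pmf (P1 w)" for w x1
  proof -
    have "set_pmf (C w x1) \<subseteq> set_pmf (map_pmf snd (K w))" using that by (auto simp flip: C2)
    then show ?thesis using F(3)[OF that(1)] finite_subset by fastforce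
  qed
  have finD: "finite (set_pmf (D w y2))" if "w \<in> set_pmf p" "y2 \<in> set_pmf (Q2 w)" for w y2
  proof -
    have "set_pmf (D w y2) \<subseteq> set_pmf (map_pmf fst (L w))" using that by (auto simp flip: D1)
    then show ?thesis using F(4)[OF that(1)] finite_subset by fastforce
  qed
  \<comment> \<open>\<open>p1\<close> is the law of (W, Y2) and \<open>p2\<close> the law of (W,
    X1).\<close>
  define p1 where "p1 = bind_pmf p (\<lambda>w. map_pmf (Pair w) (Q2 w))"
  define p2 where "p2 = bind_pmf p (\<lambda>w. map_pmf (Pair w) (P1 w))"
  have E1: "expect p1 f = expect p (\<lambda>w. expect (Q2 w) (\<lambda>y2. f (w, y2)))" for f
    unfolding p1_def using F(1) finQ2 by (subst expect_bind) auto
  have E2: "expect p2 f = expect p (\<lambda>w. expect (P1 w) (\<lambda>x1. f (w, x1)))" for f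
    unfolding p2_def using F(1) finP1 by (subst expect_bind) auto
  show ?thesis
  proof
    have "bind_pmf p1 (\<lambda>(w, y2). pair_pmf (P1 w) (D w y2)) = bind_pmf p (\<lambda>w. pair_pmf (P1 w) (bind_pmf (Q2 w) (D w)))"
      by (simp add: p1_def bind_assoc_pmf bind_map_pmf pair_bind_pmf_right)
    also have "\<dots> = map_pmf (map_prod fst fst) ?\<pi>"
      unfolding F(2)[symmetric] D1 P1_def by (simp add: map_bind_pmf map_prod_def map_pair)
    finally show "decomposition \<pi>1 p1 (\<lambda>(w, y2). P1 w) (\<lambda>(w, y2). D w y2)"
      using F(1) finQ2 by (auto simp: decomposition_def product_source_marginals split_beta case_prod_beta' p1_def)
    have "bind_pmf p2 (\<lambda>(w, x1). pair_pmf (C w x1) (Q2 w)) = bind_pmf p (\<lambda>w. pair_pmf (bind_pmf (P1 w) (C w)) (Q2 w))"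
      by (simp add: p2_def bind_assoc_pmf bind_map_pmf pair_bind_pmf_left)
    also have "\<dots> = map_pmf (map_prod snd snd) ?\<pi>"
      unfolding F(2)[symmetric] C2 Q2_def by (simp add: map_bind_pmf map_prod_def map_pair)
    finally show "decomposition \<pi>2 p2 (\<lambda>(w, x1). C w x1) (\<lambda>(w, x1). Q2 w)"
      using F(1) finP1 by (auto simp: decomposition_def product_source_marginals split_beta case_prod_beta' p2_def)
    have "phi_rate \<pi>1 p1 (\<lambda>(w, y2). P1 w) (\<lambda>(w, y2). D w y2) + phi_rate \<pi>2 p2 (\<lambda>(w, x1). C w x1) (\<lambda>(w, x1). Q2 w)
        = expect p (\<lambda>w. expect (Q2 w) (\<lambda>y2. phi \<pi>1 (P1 w) (D w y2)) + expect (P1 w) (\<lambda>x1. phi \<pi>2 (C w x1) (Q2 w)))"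
      using F(1) by (simp add: phi_rate_def E1 E2 expect_add)
    also have "\<dots> \<le> phi_rate ?\<pi> p K L"
      unfolding phi_rate_def using F finP1 finQ2 finC finD
      by (intro expect_mono phi_product_ge[OF C D])
    finally show "phi_rate \<pi>1 p1 (\<lambda>(w, y2). P1 w) (\<lambda>(w, y2). D w y2)
      + phi_rate \<pi>2 p2 (\<lambda>(w, x1). C w x1) (\<lambda>(w, x1). Q2 w) \<le> phi_rate ?\<pi> p K L" .
    \<comment> \<open>H(X1, X2|W) = H(X1|W) + H(X2|W, X1). The unconditional entropies add because
      the two sources are independent, hence the equality of information rates.\<close>
    have "expect p (\<lambda>w. entropy_nats (K w))
        = expect p (\<lambda>w. entropy_nats (P1 w) + expect (P1 w) (\<lambda>x1. entropy_nats (C w x1)))"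
      using finP1 finC by (intro expect_cong) (subst C, intro entropy_nats_chain)
    then show "info_rate \<pi>1 p1 (\<lambda>(w, y2). P1 w) + info_rate \<pi>2 p2 (\<lambda>(w, x1). C w x1) = info_rate ?\<pi> p K"
      using F(1) fin by (simp add: info_rate_def E1 E2 expect_add product_source_marginals entropy_nats_pair)
  qed
qed

lemma region_product_source:
  fixes \<pi>1 :: "('a::countable \<times> 'b::countable) pmf" and \<pi>2 :: "('c::countable \<times> 'd::countable) pmf"
  assumes fin: "finite (set_pmf \<pi>1)" "finite (set_pmf \<pi>2)"
  shows "region (product_source \<pi>1 \<pi>2) = region \<pi>1 + region \<pi>2"
proof
  show "region \<pi>1 + region \<pi>2 \<subseteq> region (product_source \<pi>1 \<pi>2)"
    using region_add_subset[OF fin] by (auto simp: set_plus_def)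
  show "region (product_source \<pi>1 \<pi>2) \<subseteq> region \<pi>1 + region \<pi>2"
  proof clarify
    fix a r assume "(a, r) \<in> region (product_source \<pi>1 \<pi>2)"
    then obtain p :: "nat pmf" and K L where
      dec: "decomposition (product_source \<pi>1 \<pi>2) p K L"
      and ar: "phi_rate (product_source \<pi>1 \<pi>2) p K L \<le> a" "info_rate (product_source \<pi>1 \<pi>2) p K \<le> r"
      using region_iff[OF finite_product_source[OF fin]] by blast
    obtain p1 :: "(nat \<times> 'd) pmf" and K1 L1 and p2 :: "(nat \<times> 'a) pmf" and K2 L2
      where 1: "decomposition \<pi>1 p1 K1 L1" and 2: "decomposition \<pi>2 p2 K2 L2"
        and le: "phi_rate \<pi>1 p1 K1 L1 + phi_rate \<pi>2 p2 K2 L2 \<le> phi_rate (product_source \<pi>1 \<pi>2) p K L"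
          "info_rate \<pi>1 p1 K1 + info_rate \<pi>2 p2 K2 = info_rate (product_source \<pi>1 \<pi>2) p K"
      using decomposition_split[OF fin dec] by metis
    \<comment> \<open>The first summand takes exactly the rates of the first source; the second
      absorbs all the slack.\<close>
    let ?a = "phi_rate \<pi>1 p1 K1 L1" and ?r = "info_rate \<pi>1 p1 K1"
    have "(?a, ?r) \<in> region \<pi>1" using fin(1) 1 by (rule in_regionI) auto
    moreover have "(a - ?a, r - ?r) \<in> region \<pi>2"
      using fin(2) 2 by (rule in_regionI) (use le ar in linarith)+
    ultimately show "(a, r) \<in> region \<pi>1 + region \<pi>2"
      using set_plus_intro[of "(?a, ?r)" _ "(a - ?a, r - ?r)"] by simp
  qed
qed

subsection \<open>Memoryless sources\<close>

lemma finite_iid_source: "finite (set_pmf \<pi>) \<Longrightarrow> finite (set_pmf (iid_source n \<pi>))"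
proof -
  assume fin: "finite (set_pmf \<pi>)"
  have "set_pmf (replicate_pmf n \<pi>) \<subseteq> {xs. set xs \<subseteq> set_pmf \<pi> \<and> length xs = n}"
    by (auto simp: set_replicate_pmf)
  then have "finite (set_pmf (replicate_pmf n \<pi>))"
    using finite_lists_length_eq[OF fin] finite_subset by blast
  then show ?thesis by (simp add: iid_source_def)
qed

lemma iid_source_1: "iid_source 1 \<pi> = map_pmf (map_prod (\<lambda>x. [x]) (\<lambda>y. [y])) \<pi>"
  by (simp add: iid_source_def map_bind_pmf bind_return_pmf map_pmf_def[symmetric] map_pmf_comp map_prod_def split_beta)
    (simp add: map_pmf_def case_prod_beta')

text \<open>Consing a letter in each component is an injective relabelling of a product source,
  which is the form that \<open>region_map\<close> and \<open>region_product_source\<close>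
  handle.\<close>

lemma iid_source_Suc:
  "iid_source (Suc n) \<pi>
    = map_pmf (map_prod (case_prod (#)) (case_prod (#))) (product_source \<pi> (iid_source n \<pi>))"
  by (simp add: iid_source_def product_source_def pair_pmf_def map_bind_pmf bind_map_pmf bind_return_pmf
      bind_assoc_pmf split_beta)

text \<open>Product additivity reduces the induction step to S + n S = (n + 1) S for S =
  \<open>region \<pi>\<close>, and this holds because S is convex.\<close>

lemma region_iid_source:
  fixes \<pi> :: "('a::countable \<times> 'b::countable) pmf"
  assumes fin: "finite (set_pmf \<pi>)" and "1 \<le> n"
  shows "region (iid_source n \<pi>) = (\<lambda>z. real n *\<^sub>R z) ` region \<pi>"
  using assms(2)
proof (induction n rule: dec_induct)
  case base
  have "region (iid_source 1 \<pi>) = region \<pi>"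
    unfolding iid_source_1 using fin by (intro region_map) (auto simp: inj_on_def)
  then show ?case by simp
next
  case (step n)
  have "region (iid_source (Suc n) \<pi>) = region (product_source \<pi> (iid_source n \<pi>))"
    unfolding iid_source_Suc using fin
    by (intro region_map finite_product_source finite_iid_source) (auto simp: inj_on_def)
  also have "\<dots> = region \<pi> + (\<lambda>z. real n *\<^sub>R z) ` region \<pi>"
    using fin by (simp add: region_product_source finite_iid_source step.IH)
  also have "\<dots> = (\<lambda>z. real (Suc n) *\<^sub>R z) ` region \<pi>"
  proof
    show "region \<pi> + (\<lambda>z. real n *\<^sub>R z) ` region \<pi> \<subseteq> (\<lambda>z. real (Suc n) *\<^sub>R z) ` region \<pi>"
    proof
      fix z assume "z \<in> region \<pi> + (\<lambda>z. real n *\<^sub>R z) ` region \<pi>"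
      then obtain u v where z: "z = u + real n *\<^sub>R v" "u \<in> region \<pi>" "v \<in> region \<pi>"
        by (auto simp: set_plus_def)
      \<comment> \<open>With this weight, u + n v is n + 1 times the convex combination of u and
        v.\<close>
      let ?t = "1 / real (Suc n)"
      have t: "1 - ?t = real n / real (Suc n)" by (simp add: field_simps)
      have "?t *\<^sub>R u + (1 - ?t) *\<^sub>R v \<in> region \<pi>"
        using z(2,3) by (intro region_convex[OF fin]) auto
      moreover have "real (Suc n) *\<^sub>R (?t *\<^sub>R u + (1 - ?t) *\<^sub>R v) = z"
        unfolding t z(1) scaleR_add_right scaleR_scaleR by simp
      ultimately show "z \<in> (\<lambda>z. real (Suc n) *\<^sub>R z) ` region \<pi>" by (metis image_eqI)
    qed
    \<comment> \<open>Here (n + 1) z = z + n z is enough, without convexity.\<close>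
    show "(\<lambda>z. real (Suc n) *\<^sub>R z) ` region \<pi> \<subseteq> region \<pi> + (\<lambda>z. real n *\<^sub>R z) ` region \<pi>"
      by (auto simp: set_plus_def scaleR_add_left algebra_simps simp del: scaleR_Pair)
  qed
  finally show ?case .
qed

theorem theorem3:
  fixes \<pi>\<^sub>1 \<pi>\<^sub>2 :: "('x::finite \<times> 'y::finite) pmf"
  shows "region (product_source \<pi>\<^sub>1 \<pi>\<^sub>2) = region \<pi>\<^sub>1 + region \<pi>\<^sub>2 \<and>
    (\<forall>(\<pi> :: ('x \<times> 'y) pmf) (n::nat). n \<ge> 1 \<longrightarrow>
       region (iid_source n \<pi>) = {real n *\<^sub>R r | r. r \<in> region \<pi>})"
  \<comment> \<open>Over finite types every support is finite, which discharges the finiteness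
    hypotheses.\<close>
  unfolding Setcompr_eq_image by (simp add: region_product_source region_iid_source)

end
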